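(* For any connected loopless multigraph $G$ with $n$ vertices, all degrees even, and $t(G)$ spanning trees, \[ \operatorname{EO}(G)\le \frac{2^{|E(G)|+3(n-1)/2}}{\pi^{(n-1)/2}\,t(G)^{1/2}}. \]
   Context: $\operatorname{EO}(G)$ is the number of Eulerian orientations of $G$, i.e. orientations of all edges (parallel edges oriented independently) such that every vertex has in-degree equal to out-degree. $E(G)$ is the edge multiset and $t(G)$ is the number of spanning trees of $G$ (counting parallel edges as distinct). *)

theory Defs
  imports Complex_Main "HOL-Library.FuncSet" "Graph_Theory.Digraph"
begin

text \<open>
  Undirected multigraphs: edges have an identity of their own, so parallel edges are distinct
  elements of \<open>edges\<close> with the same set of endpoints. The symmetric digraphs of
  \<open>Graph_Theory\<close> are not used for the undirected graph, because there an edge traversed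
  back and forth counts as a cycle; its digraphs are used for orientations below.
\<close>

record ('v, 'e) multigraph =
  vertices :: "'v set"
  edges :: "'e set"
  ends :: "'e \<Rightarrow> 'v set"

locale loopless_multigraph =
  fixes G :: "('v, 'e) multigraph"
  assumes finite_vertices: "finite (vertices G)"
    and finite_edges: "finite (edges G)"
    and ends_subset: "e \<in> edges G \<Longrightarrow> ends G e \<subseteq> vertices G"
    and card_ends: "e \<in> edges G \<Longrightarrow> card (ends G e) = 2"

definition vertex_degree :: "('v, 'e) multigraph \<Rightarrow> 'v \<Rightarrow> nat" where
  "vertex_degree G v = card {e \<in> edges G. v \<in> ends G e}"

definition adjacency :: "('v, 'e) multigraph \<Rightarrow> ('v \<times> 'v) set" where
  "adjacency G = {(u, v). \<exists>e \<in> edges G. ends G e = {u, v}}"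

definition connected_multigraph :: "('v, 'e) multigraph \<Rightarrow> bool" where
  "connected_multigraph G \<longleftrightarrow>
     vertices G \<noteq> {} \<and> (\<forall>u \<in> vertices G. \<forall>v \<in> vertices G. (u, v) \<in> (adjacency G)\<^sup>*)"

text \<open>
  A cycle visits the distinct vertices \<open>vs\<close> in cyclic order along the distinct edges \<open>es\<close>.
  Length two is allowed: two parallel edges form a cycle.
\<close>

definition is_cycle :: "('v, 'e) multigraph \<Rightarrow> 'v list \<Rightarrow> 'e list \<Rightarrow> bool" where
  "is_cycle G vs es \<longleftrightarrow>
     es \<noteq> [] \<and> length vs = length es \<and> distinct vs \<and> distinct es \<and>
     set vs \<subseteq> vertices G \<and> set es \<subseteq> edges G \<and>
     (\<forall>i < length es. ends G (es ! i) = {vs ! i, vs ! (Suc i mod length es)})"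

definition is_tree :: "('v, 'e) multigraph \<Rightarrow> bool" where
  "is_tree G \<longleftrightarrow> connected_multigraph G \<and> \<not> (\<exists>vs es. is_cycle G vs es)"

text \<open>A spanning tree is identified with its set of edges.\<close>

definition spanning_trees :: "('v, 'e) multigraph \<Rightarrow> 'e set set" where
  "spanning_trees G = {T. T \<subseteq> edges G \<and> is_tree (G\<lparr>edges := T\<rparr>)}"

text \<open>
  An orientation maps each edge to the pair (tail, head) of its endpoints. It is extensional
  (\<open>undefined\<close> off \<open>edges G\<close>), so that counting orientations is meaningful.
\<close>

definition orientations :: "('v, 'e) multigraph \<Rightarrow> ('e \<Rightarrow> 'v \<times> 'v) set" where
  "orientations G = (\<Pi>\<^sub>E e \<in> edges G. {(u, v). {u, v} = ends G e})"

definition oriented_digraph ::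
    "('v, 'e) multigraph \<Rightarrow> ('e \<Rightarrow> 'v \<times> 'v) \<Rightarrow> ('v, 'e) pre_digraph" where
  "oriented_digraph G D =
     \<lparr>verts = vertices G, arcs = edges G, tail = fst \<circ> D, head = snd \<circ> D\<rparr>"

definition eulerian_orientations :: "('v, 'e) multigraph \<Rightarrow> ('e \<Rightarrow> 'v \<times> 'v) set" where
  "eulerian_orientations G = {D \<in> orientations G. \<forall>v \<in> vertices G.
     in_degree (oriented_digraph G D) v = out_degree (oriented_digraph G D) v}"

definition EO :: "('v, 'e) multigraph \<Rightarrow> nat" where
  "EO G = card (eulerian_orientations G)"

definition num_spanning_trees :: "('v, 'e) multigraph \<Rightarrow> nat" where
  "num_spanning_trees G = card (spanning_trees G)"

end

theory Submission
  imports Defs "HOL-Probability.Distributions"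
begin

text \<open>
  Fourier inversion on \<open>(\<int>/M)\<^sup>V\<close> bounds \<open>EO G / 2\<^bsup>|E|\<^esup>\<close> by the mean of the product over
  the edges \<open>uv\<close> of \<open>|cos (\<theta>\<^sub>u - \<theta>\<^sub>v)|\<close>. Let \<open>c\<^sub>e\<close> be the fraction of the spanning trees that
  contain \<open>e\<close>. Writing each factor as a product over the trees through \<open>e\<close>, Hoelder's inequality
  reduces the mean to means over single trees, where the differences along the edges are independent;
  as \<open>M\<close> grows, \<open>cos x \<le> exp (-x\<^sup>2/2)\<close> yields the factors \<open>(2 c\<^sub>e / \<pi>)\<close> to the power \<open>c\<^sub>e / 2\<close>.
  The sum of the \<open>c\<^sub>e\<close> is \<open>n - 1\<close>, and the product of the \<open>c\<^sub>e\<close> to the power \<open>c\<^sub>e\<close> is at most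
  \<open>e\<^bsup>n-1\<^esup> / t(G)\<close> by the subadditivity of entropy, here an AM-GM argument. This gives the claim with
  \<open>2e/\<pi>\<close> in place of \<open>8/\<pi>\<close>.
\<close>

subsection \<open>Spanning trees grown leaf by leaf\<close>

text \<open>Connectedness without cycles offers no induction; growth leaf by leaf does. Only the map
  from edges to their ends enters, so \<open>V\<close> and \<open>T\<close> can vary while
  \<open>\<epsilon>\<close> stays fixed.\<close>

inductive grown_tree :: "('e \<Rightarrow> 'v set) \<Rightarrow> 'v set \<Rightarrow> 'e set \<Rightarrow> bool" for \<epsilon> where
  single: "grown_tree \<epsilon> {v} {}"
| grow: "grown_tree \<epsilon> V T \<Longrightarrow> u \<in> V \<Longrightarrow> w \<notin> V \<Longrightarrow> \<epsilon> e = {u, w} \<Longrightarrow>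
    grown_tree \<epsilon> (insert w V) (insert e T)"

lemma grown_tree_finite: "grown_tree \<epsilon> V T \<Longrightarrow> finite V \<and> finite T"
  by (induction rule: grown_tree.induct) auto

lemma grown_tree_ends_subset: "grown_tree \<epsilon> V T \<Longrightarrow> e \<in> T \<Longrightarrow> \<epsilon> e \<subseteq> V"
  by (induction rule: grown_tree.induct) auto

lemma grown_tree_new_edge:
  "grown_tree \<epsilon> V T \<Longrightarrow> w \<notin> V \<Longrightarrow> \<epsilon> e = {u, w} \<Longrightarrow> e \<notin> T"
  using grown_tree_ends_subset by fastforce

lemma grown_tree_card: "grown_tree \<epsilon> V T \<Longrightarrow> card V = Suc (card T)"
proof (induction rule: grown_tree.induct)
  case (grow V T u w e)
  then show ?case
    using grown_tree_new_edge[OF grow(1) grow(3,4)] grown_tree_finite[OF grow(1)] by simp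
qed simp

section \<open>Paths and cycles in grown trees\<close>

text \<open>Shaped after \<open>is_cycle\<close>: a further edge from the last vertex back to the
  first turns a path into a cycle on the same list \<open>vs\<close>.\<close>

definition simple_path ::
    "('e \<Rightarrow> 'v set) \<Rightarrow> 'v set \<Rightarrow> 'e set \<Rightarrow> 'v \<Rightarrow> 'v \<Rightarrow> 'v list \<Rightarrow> 'e list \<Rightarrow> bool" where
  "simple_path \<epsilon> V T x y vs es \<longleftrightarrow>
     length vs = Suc (length es) \<and> distinct vs \<and> distinct es \<and> set vs \<subseteq> V \<and> set es \<subseteq> T \<and>
     hd vs = x \<and> last vs = y \<and> (\<forall>i < length es. \<epsilon> (es ! i) = {vs ! i, vs ! Suc i})"

lemma simple_path_ends:
  assumes "simple_path \<epsilon> V T x y vs es"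
  shows "vs \<noteq> []" "vs ! 0 = x" "vs ! length es = y"
proof -
  show "vs \<noteq> []" using assms by (auto simp: simple_path_def)
  then show "vs ! 0 = x" "vs ! length es = y"
    using assms by (auto simp: simple_path_def hd_conv_nth last_conv_nth)
qed

lemma simple_path_singleton: "x \<in> V \<Longrightarrow> simple_path \<epsilon> V T x x [x] []"
  by (simp add: simple_path_def)

lemma simple_path_mono:
  "simple_path \<epsilon> V T x y vs es \<Longrightarrow> V \<subseteq> V' \<Longrightarrow> T \<subseteq> T' \<Longrightarrow> simple_path \<epsilon> V' T' x y vs es"
  by (auto simp: simple_path_def)

lemma simple_path_Cons:
  assumes "simple_path \<epsilon> V T u y vs es" "w \<notin> V" "e \<notin> T" "\<epsilon> e = {u, w}"
  shows "simple_path \<epsilon> (insert w V) (insert e T) w y (w # vs) (e # es)"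
  using assms simple_path_ends[OF assms(1)]
  by (auto simp: simple_path_def nth_Cons split: nat.split)

lemma simple_path_snoc:
  assumes "simple_path \<epsilon> V T x u vs es" "w \<notin> V" "e \<notin> T" "\<epsilon> e = {u, w}"
  shows "simple_path \<epsilon> (insert w V) (insert e T) x w (vs @ [w]) (es @ [e])"
  using assms simple_path_ends[OF assms(1)]
  by (auto simp: simple_path_def nth_append less_Suc_eq)

text \<open>Old vertices keep their paths; a path between the new leaf \<open>w\<close> and an old
  vertex is one at its neighbour \<open>u\<close>, extended by \<open>e\<close> at the front or at
  the back.\<close>

lemma grown_tree_path:
  "grown_tree \<epsilon> V T \<Longrightarrow> x \<in> V \<Longrightarrow> y \<in> V \<Longrightarrow> \<exists>vs es. simple_path \<epsilon> V T x y vs es"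
proof (induction arbitrary: x y rule: grown_tree.induct)
  case (single v)
  then have "simple_path \<epsilon> {v} {} x y [v] []" by (simp add: simple_path_singleton)
  then show ?case by blast
next
  case (grow V T u w e)
  note e = grown_tree_new_edge[OF grow(1) grow(3,4)]
  consider "x \<in> V" "y \<in> V" | "x = w" "y \<in> V" | "x \<in> V" "y = w" | "x = w" "y = w"
    using grow.prems by blast
  then show ?case
  proof cases
    case 1
    then obtain vs es where "simple_path \<epsilon> V T x y vs es" using grow.IH by blast
    then have "simple_path \<epsilon> (insert w V) (insert e T) x y vs es"
      by (rule simple_path_mono) auto
    then show ?thesis by blast
  next
    case 2
    then obtain vs es where "simple_path \<epsilon> V T u y vs es" using grow.IH \<open>u \<in> V\<close> by blast
    from simple_path_Cons[OF this grow(3) e grow(4)] show ?thesis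
      using \<open>x = w\<close> by blast
  next
    case 3
    then obtain vs es where "simple_path \<epsilon> V T x u vs es" using grow.IH \<open>u \<in> V\<close> by blast
    from simple_path_snoc[OF this grow(3) e grow(4)] show ?thesis
      using \<open>y = w\<close> by blast
  next
    case 4
    then have "simple_path \<epsilon> (insert w V) (insert e T) x y [w] []"
      by (simp add: simple_path_singleton)
    then show ?thesis by blast
  qed
qed

lemma grown_tree_connected:
  assumes "grown_tree (ends G) V (edges G)" "vertices G = V"
  shows "connected_multigraph G"
proof -
  have "(x, y) \<in> (adjacency G)\<^sup>*" if xy: "x \<in> V" "y \<in> V" for x y
  proof -
    obtain vs es where p: "simple_path (ends G) V (edges G) x y vs es"
      using grown_tree_path[OF assms(1) xy] by blast
    have "(vs ! 0, vs ! i) \<in> (adjacency G)\<^sup>*" if "i \<le> length es" for i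
      using that
    proof (induction i)
      case (Suc i)
      then have "es ! i \<in> edges G" "ends G (es ! i) = {vs ! i, vs ! Suc i}"
        using p nth_mem[of i es] by (auto simp: simple_path_def)
      then have "(vs ! i, vs ! Suc i) \<in> adjacency G"
        unfolding adjacency_def by blast
      then show ?case using Suc by (auto intro: rtrancl_into_rtrancl)
    qed simp
    then show ?thesis using simple_path_ends[OF p] by (metis order.refl)
  qed
  moreover have "V \<noteq> {}" using assms(1) by (cases rule: grown_tree.cases) auto
  ultimately show ?thesis
    using assms(2) by (simp add: connected_multigraph_def)
qed

text \<open>The newest edge is the only one at the newest leaf, so it lies on no cycle. A cycle
  would thus survive into every earlier stage, down to the empty edge set.\<close>

lemma grown_tree_acyclic:
  "grown_tree \<epsilon> V T \<Longrightarrow> set es \<subseteq> T \<Longrightarrow> es \<noteq> [] \<Longrightarrow> length vs = length es \<Longrightarrow> distinct vs \<Longrightarrow>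
    distinct es \<Longrightarrow> (\<forall>e \<in> T. card (\<epsilon> e) = 2) \<Longrightarrow>
    (\<forall>i < length es. \<epsilon> (es ! i) = {vs ! i, vs ! (Suc i mod length es)}) \<Longrightarrow> False"
proof (induction rule: grown_tree.induct)
  case (grow V T u w e)
  let ?n = "length es"
  note e = grown_tree_new_edge[OF grow(1) grow(3,4)]
  have n0: "?n > 0" using grow by simp
  have uniq: "e' = e" if "e' \<in> insert e T" "w \<in> \<epsilon> e'" for e'
    using that grown_tree_ends_subset[OF grow(1)] grow(3) by auto
  \<comment> \<open>A cycle of length one would be a loop.\<close>
  have n1: "?n \<noteq> 1"
  proof
    assume "?n = 1"
    then have "\<epsilon> (es ! 0) = {vs ! 0}" "es ! 0 \<in> insert e T"
      using grow.prems(7) subsetD[OF grow.prems(1) nth_mem[of 0 es]] by auto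
    moreover have "card (\<epsilon> (es ! 0)) = 2" using calculation(2) grow.prems(6) by blast
    ultimately show False by simp
  qed
  text \<open>A leaf cannot lie on a cycle: its two cycle edges would be distinct.\<close>
  have w: "w \<noteq> vs ! (Suc i mod ?n)" if "i < ?n" for i
  proof
    assume *: "w = vs ! (Suc i mod ?n)"
    have lt: "Suc i mod ?n < ?n" using n0 by simp
    have "w \<in> \<epsilon> (es ! i)" "w \<in> \<epsilon> (es ! (Suc i mod ?n))"
      using grow.prems that lt * by auto
    then have "es ! i = es ! (Suc i mod ?n)"
      using uniq that lt grow.prems(1) nth_mem by (metis subsetD)
    then have "i = Suc i mod ?n"
      using that lt grow.prems(5) nth_eq_iff_index_eq by blast
    then show False using n1 that by (cases "Suc i = ?n") auto
  qed
  have "e \<notin> set es"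
  proof
    assume "e \<in> set es"
    then obtain i where i: "i < ?n" "es ! i = e" by (auto simp: in_set_conv_nth)
    then have "w \<in> {vs ! i, vs ! (Suc i mod ?n)}" using grow by auto
    then have "w = vs ! i" using w i by auto
    \<comment> \<open>Every position on the cycle is a cyclic successor, so the fact
      \<open>w\<close>, stated for successors, also covers \<open>vs ! i\<close>.\<close>
    moreover have "\<exists>j < ?n. Suc j mod ?n = i"
    proof (cases i)
      case 0
      then show ?thesis using n0 by (intro exI[of _ "?n - 1"]) auto
    next
      case (Suc j)
      then show ?thesis using i by (intro exI[of _ j]) auto
    qed
    ultimately show False using w by blast
  qed
  then have "set es \<subseteq> T" using grow.prems(1) by blast
  then show ?case using grow.IH grow.prems by simp
qed simp

section \<open>Spanning trees as grown trees\<close>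

text \<open>Take an inclusion-maximal vertex set that carries a grown tree in \<open>G\<close>. An
  edge leaving it would let it grow, so it is closed under adjacency, and connectedness makes it
  everything.\<close>

lemma connected_has_grown_tree:
  assumes "loopless_multigraph G" "connected_multigraph G"
  shows "\<exists>T \<subseteq> edges G. grown_tree (ends G) (vertices G) T"
proof -
  define \<A> where "\<A> = {V. V \<subseteq> vertices G \<and> (\<exists>T \<subseteq> edges G. grown_tree (ends G) V T)}"
  obtain v0 where v0: "v0 \<in> vertices G" using assms(2) by (auto simp: connected_multigraph_def)
  have "finite \<A>" using assms(1) by (simp add: loopless_multigraph_def \<A>_def)
  moreover have "{v0} \<in> \<A>"
    using v0 grown_tree.single[of "ends G" v0] unfolding \<A>_def by auto
  ultimately obtain V where V: "V \<in> \<A>" "\<forall>W \<in> \<A>. V \<subseteq> W \<longrightarrow> V = W"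
    using finite_has_maximal[of \<A>] by blast
  then obtain T where T: "T \<subseteq> edges G" "grown_tree (ends G) V T"
    unfolding \<A>_def by blast
  obtain x where x: "x \<in> V" using T(2) by (cases rule: grown_tree.cases) auto
  have closed: "v \<in> V" if uv: "u \<in> V" "(u, v) \<in> adjacency G" for u v
  proof (rule ccontr)
    assume "v \<notin> V"
    obtain e where e: "e \<in> edges G" "ends G e = {u, v}" 
      using uv(2) by (auto simp: adjacency_def)
    have "grown_tree (ends G) (insert v V) (insert e T)"
      using grown_tree.grow T(2) uv(1) \<open>v \<notin> V\<close> e(2) by metis
    moreover have "v \<in> vertices G"
      using e assms(1) loopless_multigraph.ends_subset by fastforce
    ultimately have "insert v V \<in> \<A>" using V(1) T(1) e(1) unfolding \<A>_def by blast
    then show False using V(2) \<open>v \<notin> V\<close> by blast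
  qed
  have "y \<in> V" if "(x, y) \<in> (adjacency G)\<^sup>*" for y
    using that by (induction rule: rtrancl_induct) (use x closed in auto)
  moreover have "V \<subseteq> vertices G" using V(1) by (simp add: \<A>_def)
  ultimately have "V = vertices G"
    using x assms(2) unfolding connected_multigraph_def by blast
  then show ?thesis using T by blast
qed

lemma loopless_multigraph_subset:
  "loopless_multigraph G \<Longrightarrow> T \<subseteq> edges G \<Longrightarrow> loopless_multigraph (G\<lparr>edges := T\<rparr>)"
  by (auto simp: loopless_multigraph_def intro: finite_subset)

text \<open>A tree \<open>T'\<close> grown inside \<open>T\<close> already spans. An edge of
  \<open>T\<close> missing from \<open>T'\<close> would close a cycle in \<open>T\<close> with the
  path of \<open>T'\<close> between its ends, so \<open>T' = T\<close>.\<close>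

lemma spanning_tree_grown:
  assumes G: "loopless_multigraph G" and T: "T \<in> spanning_trees G"
  shows "grown_tree (ends G) (vertices G) T"
proof -
  let ?H = "G\<lparr>edges := T\<rparr>"
  have H: "T \<subseteq> edges G" "connected_multigraph ?H" "\<And>vs es. \<not> is_cycle ?H vs es"
    using T by (auto simp: spanning_trees_def is_tree_def)
  obtain T' where T': "T' \<subseteq> T" "grown_tree (ends G) (vertices G) T'"
    using connected_has_grown_tree[OF loopless_multigraph_subset[OF G H(1)] H(2)] by auto
  have "e \<in> T'" if e: "e \<in> T" for e
  proof (rule ccontr)
    assume "e \<notin> T'"
    have "card (ends G e) = 2" "ends G e \<subseteq> vertices G"
      using e H(1) G by (auto simp: loopless_multigraph_def)
    then obtain x y where xy: "ends G e = {y, x}" "x \<in> vertices G" "y \<in> vertices G"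
      by (metis card_2_iff insert_subset)
    then obtain vs es where p: "simple_path (ends G) (vertices G) T' x y vs es"
      using grown_tree_path T'(2) by metis
    then have "vs ! 0 = x" "vs ! length es = y"
      using simple_path_ends by metis+
    \<comment> \<open>The closing edge \<open>e\<close> sits at index \<open>length es\<close>,
      where the successor wraps around to \<open>vs ! 0\<close>, which is \<open>x\<close>.\<close>
    then have "ends G ((es @ [e]) ! i) = {vs ! i, vs ! (Suc i mod Suc (length es))}"
      if "i < Suc (length es)" for i
      using that p xy(1) by (cases "i = length es") (auto simp: simple_path_def nth_append)
    then have "is_cycle ?H vs (es @ [e])"
      using p T'(1) e \<open>e \<notin> T'\<close> by (auto simp: is_cycle_def simple_path_def)
    then show False using H(3) by blast
  qed
  then show ?thesis using T' by (metis subsetI subset_antisym)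
qed

text \<open>Makes means over the spanning trees, and the exponents \<open>1 / card \<T>\<close>,
  meaningful.\<close>

lemma spanning_trees_nonempty:
  assumes G: "loopless_multigraph G" "connected_multigraph G"
  shows "spanning_trees G \<noteq> {}"
proof -
  obtain T where T: "T \<subseteq> edges G" "grown_tree (ends G) (vertices G) T"
    using connected_has_grown_tree[OF G] by blast
  have "connected_multigraph (G\<lparr>edges := T\<rparr>)"
    using grown_tree_connected[of "G\<lparr>edges := T\<rparr>"] T(2) by simp
  moreover have "\<forall>e \<in> T. card (ends G e) = 2"
    using T(1) loopless_multigraph.card_ends[OF G(1)] by blast
  then have "\<not> is_cycle (G\<lparr>edges := T\<rparr>) vs es" for vs es
    using grown_tree_acyclic[OF T(2), of es vs] by (intro notI) (simp add: is_cycle_def)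
  ultimately show ?thesis using T(1) by (auto simp: spanning_trees_def is_tree_def)
qed

section \<open>Sums over vertex labels along a tree\<close>

lemma sum_PiE_insert:
  assumes "finite V" "w \<notin> V"
  shows "(\<Sum>k\<in>PiE (insert w V) B. f k) = (\<Sum>k\<in>PiE V B. \<Sum>x\<in>B w. f (k(w := x)))"
proof -
  have "(\<Sum>k\<in>PiE (insert w V) B. f k) = (\<Sum>p\<in>B w \<times> PiE V B. f ((snd p)(w := fst p)))"
    unfolding PiE_insert_eq
    using inj_combinator[OF assms(2), of B]
    by (subst sum.reindex) (auto simp: case_prod_beta')
  also have "\<dots> = (\<Sum>x\<in>B w. \<Sum>k\<in>PiE V B. f (k(w := x)))"
    by (simp add: sum.cartesian_product case_prod_beta')
  also have "\<dots> = (\<Sum>k\<in>PiE V B. \<Sum>x\<in>B w. f (k(w := x)))"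
    by (rule sum.swap)
  finally show ?thesis .
qed

text \<open>Summing over the value at the last leaf first factors out its edge.\<close>
lemma grown_tree_sum:
  fixes \<phi> :: "'e \<Rightarrow> 'a \<Rightarrow> 'a \<Rightarrow> real"
  assumes "grown_tree \<epsilon> V T"
    and "\<And>e. e \<in> T \<Longrightarrow> \<epsilon> e = {a e, b e}"
    and "\<And>e y. e \<in> T \<Longrightarrow> y \<in> A \<Longrightarrow> (\<Sum>x\<in>A. \<phi> e x y) = S e"
    and "\<And>e y. e \<in> T \<Longrightarrow> y \<in> A \<Longrightarrow> (\<Sum>x\<in>A. \<phi> e y x) = S e"
  shows "(\<Sum>k\<in>PiE V (\<lambda>_. A). \<Prod>e\<in>T. \<phi> e (k (a e)) (k (b e))) = real (card A) * (\<Prod>e\<in>T. S e)"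
  using assms
proof (induction rule: grown_tree.induct)
  case (single v)
  then show ?case by (simp add: card_PiE)
next
  case (grow V T u w e)
  note e = grown_tree_new_edge[OF grow(1) grow(3,4)]
  note fin = grown_tree_finite[OF grow(1)]
  have old: "a e' \<noteq> w" "b e' \<noteq> w" if "e' \<in> T" for e'
    using grown_tree_ends_subset[OF grow(1) that] grow.prems(1)[of e'] that grow(3) by auto
  \<comment> \<open>The order of \<open>a e\<close> and \<open>b e\<close> is unrelated to the
    growth, so the leaf may be either argument of \<open>\<phi> e\<close>; there is one summation
    hypothesis for each case.\<close>
  have new: "(\<Sum>x\<in>A. \<phi> e ((k(w := x)) (a e)) ((k(w := x)) (b e))) = S e"
    if "k \<in> PiE V (\<lambda>_. A)" for k
  proof -
    have uw: "u \<noteq> w" "k u \<in> A" using grow(2,3) that by auto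
    have "{a e, b e} = {u, w}" using grow.prems(1)[of e] grow(4) by simp
    then consider "a e = u" "b e = w" | "a e = w" "b e = u" by (auto simp: doubleton_eq_iff)
    then show ?thesis using uw grow.prems(2,3)[of e "k u"] by cases auto
  qed
  have "(\<Sum>k\<in>PiE (insert w V) (\<lambda>_. A). \<Prod>e\<in>insert e T. \<phi> e (k (a e)) (k (b e)))
      = (\<Sum>k\<in>PiE V (\<lambda>_. A). \<Sum>x\<in>A. \<phi> e ((k(w := x)) (a e)) ((k(w := x)) (b e)) *
          (\<Prod>e\<in>T. \<phi> e (k (a e)) (k (b e))))"
    using fin e old by (subst sum_PiE_insert) (auto simp: grow(3) intro!: sum.cong prod.cong)
  also have "\<dots> = (\<Sum>k\<in>PiE V (\<lambda>_. A). S e * (\<Prod>e\<in>T. \<phi> e (k (a e)) (k (b e))))"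
    using new by (intro sum.cong refl) (simp only: flip: sum_distrib_right)
  also have "\<dots> = real (card A) * (\<Prod>e\<in>insert e T. S e)"
    using fin e grow.IH grow.prems by (simp flip: sum_distrib_left)
  finally show ?case .
qed

subsection \<open>Means of powers of the cosine\<close>

text \<open>The derivative of \<open>cos x * exp (x\<^sup>2 / 2)\<close> has the sign of
  \<open>x * cos x - sin x\<close>, which starts at 0 and has derivative \<open>- x * sin x\<close>,
  so it is nonpositive up to \<open>pi\<close>.\<close>

lemma cos_le_exp_neg_square:
  fixes x :: real
  assumes "0 \<le> x" "x \<le> pi"
  shows "cos x \<le> exp (- x\<^sup>2 / 2)"
proof -
  have sin: "y * cos y \<le> sin y" if "0 \<le> y" "y \<le> x" for y
  proof -
    have "y * cos y - sin y \<le> 0 * cos 0 - sin 0"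
    proof (rule DERIV_nonpos_imp_nonincreasing[of 0 y "\<lambda>y. y * cos y - sin y"])
      fix z assume "0 \<le> z" "z \<le> y"
      then have "sin z \<ge> 0" using that assms by (intro sin_ge_zero) auto
      then show "\<exists>d. ((\<lambda>y. y * cos y - sin y) has_real_derivative d) (at z) \<and> d \<le> 0"
        using \<open>0 \<le> z\<close> by (intro exI[of _ "- (z * sin z)"])
          (auto intro!: derivative_eq_intros simp: algebra_simps)
    qed (use that in auto)
    then show ?thesis by simp
  qed
  have "cos x * exp (x\<^sup>2 / 2) \<le> cos 0 * exp (0\<^sup>2 / 2)"
  proof (rule DERIV_nonpos_imp_nonincreasing[of 0 x "\<lambda>y. cos y * exp (y\<^sup>2 / 2)"])
    fix y assume y: "0 \<le> y" "y \<le> x"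
    have "((\<lambda>y. cos y * exp (y\<^sup>2 / 2)) has_real_derivative (y * cos y - sin y) * exp (y\<^sup>2 / 2)) (at y)"
      by (auto intro!: derivative_eq_intros simp: algebra_simps)
    then show "\<exists>d. ((\<lambda>y. cos y * exp (y\<^sup>2 / 2)) has_real_derivative d) (at y) \<and> d \<le> 0"
      using sin[OF y] by (auto simp: mult_le_0_iff)
  qed (use assms in auto)
  then show ?thesis by (simp add: exp_minus field_simps)
qed

text \<open>The integrand decreases on the half line, so rectangles at right endpoints lie below its
  graph. The bound is the full half-line integral and hence uniform in \<open>K\<close>.\<close>

lemma gaussian_riemann_sum:
  fixes \<delta> :: real
  assumes "\<delta> > 0"
  shows "\<delta> * (\<Sum>j=1..K. exp (- (real j * \<delta>)\<^sup>2)) \<le> sqrt pi / 2"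
proof -
  let ?f = "\<lambda>x::real. exp (- x\<^sup>2)"
  have int: "?f integrable_on {a..b}" for a b
    by (intro integrable_continuous_interval continuous_intros)
  have "\<delta> * (\<Sum>j=1..K. ?f (real j * \<delta>)) \<le> integral {0..real K * \<delta>} ?f"
  proof (induction K)
    case (Suc K)
    let ?a = "real K * \<delta>" and ?b = "real (Suc K) * \<delta>"
    have ab: "0 \<le> ?a" "?a \<le> ?b" using assms by (auto simp: algebra_simps)
    have "integral {?a..?b} (\<lambda>_. ?f ?b) \<le> integral {?a..?b} ?f"
    proof (rule integral_le[OF _ int])
      fix x assume "x \<in> {?a..?b}"
      then show "?f ?b \<le> ?f x" using ab by (auto intro!: power_mono)
    qed (rule integrable_const_ivl)
    then have "\<delta> * ?f ?b \<le> integral {?a..?b} ?f"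
      using ab by (simp add: algebra_simps)
    moreover have "integral {0..?a} ?f + integral {?a..?b} ?f = integral {0..?b} ?f"
      using ab int by (intro Henstock_Kurzweil_Integration.integral_combine) auto
    moreover have "\<delta> * (\<Sum>j=1..Suc K. ?f (real j * \<delta>)) = \<delta> * (\<Sum>j=1..K. ?f (real j * \<delta>)) + \<delta> * ?f ?b"
      by (simp add: distrib_left)
    ultimately show ?case using Suc by linarith
  qed simp
  also have "\<dots> \<le> sqrt pi / 2"
  proof -
    have "((\<lambda>x. indicator {0..} x *\<^sub>R ?f x) has_integral sqrt pi / 2) UNIV"
      using gaussian_moment_0 has_integral_integral_lborel
      by (metis has_bochner_integral_iff)
    then have "((\<lambda>x. if x \<in> {0..} then ?f x else 0) has_integral sqrt pi / 2) UNIV"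
      by (rule has_integral_eq[rotated]) (auto simp: indicator_def)
    then have "(?f has_integral sqrt pi / 2) {0..}"
      by (simp only: has_integral_restrict_UNIV)
    then show ?thesis
      by (intro has_integral_subset_le[OF _ integrable_integral[OF int]]) auto
  qed
  finally show ?thesis .
qed

text \<open>With \<open>4 * K\<close> points the multiples of \<open>pi / 2\<close> lie on the grid,
  so symmetry reduces the sum to a quarter period. There the Gaussian bound on the cosine leaves a
  Riemann sum; the term at angle 0, equal to 1, causes the error \<open>1 / real K\<close>.\<close>

lemma sum_abs_cos_powr_le:
  fixes K :: nat and s :: real
  assumes K: "K > 0" and s: "s > 0"
  shows "(\<Sum>j\<in>{0..<int (4 * K)}. \<bar>cos (2 * pi * of_int j / real (4 * K))\<bar> powr s)
    \<le> real (4 * K) * (1 / real K + sqrt (2 / (pi * s)))"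
proof -
  define \<theta> where "\<theta> j = real j * pi / (2 * real K)" for j :: nat
  define g where "g j = \<bar>cos (\<theta> j)\<bar> powr s" for j
  \<comment> \<open>Chosen so that \<open>exp (- (\<theta> j)\<^sup>2 / 2) powr s\<close> equals
    \<open>exp (- (real j * \<delta>)\<^sup>2)\<close>.\<close>
  define \<delta> where "\<delta> = pi / (2 * real K) * sqrt (s / 2)"
  have \<delta>: "\<delta> > 0" using K s by (simp add: \<delta>_def)
  have gle: "g j \<le> exp (- (real j * \<delta>)\<^sup>2)" if "j \<le> K" for j
  proof -
    have \<theta>: "0 \<le> \<theta> j" "\<theta> j \<le> pi / 2"
      using that K by (auto simp: \<theta>_def field_simps)
    then have "0 \<le> cos (\<theta> j)" by (intro cos_ge_zero) auto
    then have "\<bar>cos (\<theta> j)\<bar> \<le> exp (- (\<theta> j)\<^sup>2 / 2)"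
      using cos_le_exp_neg_square[of "\<theta> j"] \<theta> by simp
    then have "g j \<le> exp (- (\<theta> j)\<^sup>2 / 2) powr s"
      unfolding g_def using s by (intro powr_mono2) auto
    also have "\<dots> = exp (- (real j * \<delta>)\<^sup>2)"
      using s by (simp add: exp_powr_real \<delta>_def \<theta>_def power_mult_distrib power_divide)
    finally show ?thesis .
  qed
  \<comment> \<open>Both ends of the quarter are included, so \<open>B\<close> dominates the first
    quarter, which omits \<open>K\<close>, and the reflected second one, which omits 0.\<close>
  define B where "B = (\<Sum>j=0..K. g j)"
  have g0: "g j \<ge> 0" for j by (simp add: g_def)
  have "B = g 0 + (\<Sum>j=1..K. g j)"
    by (simp add: B_def sum.atLeast_Suc_atMost)
  also have "\<dots> \<le> 1 + (\<Sum>j=1..K. exp (- (real j * \<delta>)\<^sup>2))"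
    using gle by (intro add_mono sum_mono) (auto simp: g_def \<theta>_def)
  also have "\<dots> \<le> 1 + sqrt pi / 2 / \<delta>"
    using gaussian_riemann_sum[OF \<delta>, of K] \<delta> by (simp add: field_simps)
  also have "sqrt pi / 2 / \<delta> = real K * sqrt (2 / (pi * s))"
  proof -
    have "pi = sqrt pi * sqrt pi" by simp
    then show ?thesis using K s
      by (simp add: \<delta>_def real_sqrt_divide real_sqrt_mult field_simps)
  qed
  finally have B: "B \<le> 1 + real K * sqrt (2 / (pi * s))" .
  have \<theta>_add: "\<theta> (i + j) = \<theta> i + \<theta> j" for i j
    by (simp add: \<theta>_def add_divide_distrib distrib_right)
  have \<theta>K: "\<theta> K = pi / 2" using K by (simp add: \<theta>_def)
  have \<theta>2K: "\<theta> (2 * K) = pi" using K by (simp add: \<theta>_def)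
  have \<theta>_diff: "\<theta> (K - j) = pi / 2 - \<theta> j" if "j \<le> K" for j
    using that \<theta>_add[of "K - j" j] \<theta>K by simp
  \<comment> \<open>The absolute value of the cosine has period \<open>pi\<close> and is symmetric
    about \<open>pi / 2\<close>.\<close>
  have shift: "g (2 * K + j) = g j" for j
    by (simp add: g_def \<theta>_add \<theta>2K)
  have refl: "g (K + j) = g (K - j)" if "j \<le> K" for j
    using \<theta>_diff[OF that] by (simp add: g_def \<theta>_add \<theta>K cos_add cos_diff)
  have split: "(\<Sum>j<m + n. g j) = (\<Sum>j<m. g j) + (\<Sum>j<n. g (m + j))" for m n
    by (induction n) (simp_all add: add.assoc)
  have half: "(\<Sum>j<2*K. g j) \<le> 2 * B"
  proof -
    have "(\<Sum>j<2*K. g j) = (\<Sum>j<K. g j) + (\<Sum>j<K. g (K + j))"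
      using split[of K K] by (simp add: mult_2)
    also have "(\<Sum>j<K. g (K + j)) = (\<Sum>j<K. g (K - j))"
      by (intro sum.cong) (auto simp: refl)
    also have "\<dots> = (\<Sum>j\<in>{1..K}. g j)"
      by (rule sum.reindex_bij_witness[of _ "\<lambda>j. K - j" "\<lambda>j. K - j"]) auto
    also have "(\<Sum>j<K. g j) \<le> B"
      unfolding B_def using g0 by (intro sum_mono2) auto
    also have "(\<Sum>j\<in>{1..K}. g j) \<le> B"
      unfolding B_def using g0 by (intro sum_mono2) auto
    finally show ?thesis by simp
  qed
  have "(\<Sum>j\<in>{0..<int (4 * K)}. \<bar>cos (2 * pi * of_int j / real (4 * K))\<bar> powr s) = (\<Sum>j<4*K. g j)"
    by (rule sum.reindex_bij_witness[of _ int nat])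
      (auto simp: g_def \<theta>_def field_simps)
  also have "\<dots> = (\<Sum>j<2*K. g j) + (\<Sum>j<2*K. g (2 * K + j))"
    using split[of "2 * K" "2 * K"] by simp
  also have "\<dots> = 2 * (\<Sum>j<2*K. g j)"
    by (simp add: shift)
  also have "\<dots> \<le> 4 * B" using half by simp
  also have "\<dots> \<le> 4 * (1 + real K * sqrt (2 / (pi * s)))" using B by simp
  also have "\<dots> = real (4 * K) * (1 / real K + sqrt (2 / (pi * s)))"
    using K by (simp add: field_simps)
  finally show ?thesis .
qed

subsection \<open>Averaging over a family of sets\<close>

lemma prod_prod_Union:
  fixes f :: "'a \<Rightarrow> 'b::comm_monoid_mult"
  assumes "finite \<T>" "\<And>T. T \<in> \<T> \<Longrightarrow> finite T"
  shows "(\<Prod>T\<in>\<T>. \<Prod>e\<in>T. f e) = (\<Prod>e\<in>\<Union>\<T>. f e ^ card {T \<in> \<T>. e \<in> T})"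
proof -
  have "(\<Prod>T\<in>\<T>. \<Prod>e\<in>T. f e) = (\<Prod>T\<in>\<T>. \<Prod>e\<in>{e. e \<in> \<Union>\<T> \<and> e \<in> T}. f e)"
    by (intro prod.cong) auto
  also have "\<dots> = (\<Prod>e\<in>\<Union>\<T>. \<Prod>T\<in>{T. T \<in> \<T> \<and> e \<in> T}. f e)"
    using assms by (intro prod.swap_restrict) auto
  finally show ?thesis by simp
qed

text \<open>Hoelder's inequality with equal exponents: scale each \<open>g i\<close> to total 1,
  apply AM-GM at every \<open>k\<close>, and sum.\<close>

lemma Holder_prod_powr_card:
  fixes g :: "'i \<Rightarrow> 'k \<Rightarrow> real"
  assumes "finite K" "finite I" "I \<noteq> {}" and g: "\<And>i k. i \<in> I \<Longrightarrow> k \<in> K \<Longrightarrow> g i k \<ge> 0"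
  shows "(\<Sum>k\<in>K. \<Prod>i\<in>I. g i k powr (1 / card I)) \<le> (\<Prod>i\<in>I. (\<Sum>k\<in>K. g i k) powr (1 / card I))"
proof -
  define A where "A i = (\<Sum>k\<in>K. g i k)" for i
  let ?p = "1 / real (card I)"
  have A0: "A i \<ge> 0" if "i \<in> I" for i using g that by (auto simp: A_def intro: sum_nonneg)
  have I: "real (card I) > 0" using assms by (simp add: card_gt_0_iff)
  show ?thesis
  proof (cases "\<exists>i\<in>I. A i = 0")
    \<comment> \<open>A zero total cannot be scaled, but then \<open>g i\<close> vanishes on
      \<open>K\<close> and so does the left-hand side.\<close>
    case True
    then obtain i where i: "i \<in> I" "A i = 0" by blast
    then have "g i k = 0" if "k \<in> K" for k
      using sum_nonneg_eq_0_iff[OF \<open>finite K\<close>, of "g i"] g that by (auto simp: A_def)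
    then have "(\<Sum>k\<in>K. \<Prod>i\<in>I. g i k powr ?p) = 0"
      using i(1) \<open>finite I\<close> by (intro sum.neutral) auto
    then show ?thesis by (simp add: prod_nonneg)
  next
    case False
    have "(\<Sum>k\<in>K. \<Prod>i\<in>I. g i k powr ?p) \<le> (\<Sum>k\<in>K. (\<Prod>i\<in>I. A i powr ?p) * (\<Sum>i\<in>I. g i k / A i / card I))"
    proof (rule sum_mono)
      fix k assume k: "k \<in> K"
      have "(\<Prod>i\<in>I. g i k powr ?p) = (\<Prod>i\<in>I. A i powr ?p * (g i k / A i) powr ?p)"
        using False by (intro prod.cong) (auto simp flip: powr_mult)
      also have "\<dots> = (\<Prod>i\<in>I. A i powr ?p) * (\<Prod>i\<in>I. g i k / A i) powr ?p"
        by (simp add: prod.distrib prod_powr_distrib)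
      also have "\<dots> \<le> (\<Prod>i\<in>I. A i powr ?p) * (\<Sum>i\<in>I. g i k / A i / card I)"
        using assms A0 k by (intro mult_left_mono arith_geom_mean prod_nonneg) auto
      finally show "(\<Prod>i\<in>I. g i k powr ?p) \<le> (\<Prod>i\<in>I. A i powr ?p) * (\<Sum>i\<in>I. g i k / A i / card I)" .
    qed
    also have "\<dots> = (\<Prod>i\<in>I. A i powr ?p) * (\<Sum>i\<in>I. \<Sum>k\<in>K. g i k / A i / card I)"
      by (simp add: sum.swap[of _ I K] flip: sum_distrib_left)
    also have "(\<Sum>i\<in>I. \<Sum>k\<in>K. g i k / A i / card I) = (\<Sum>i\<in>I. 1 / card I)"
      using False by (intro sum.cong refl) (simp add: A_def flip: sum_divide_distrib)
    also have "\<dots> = 1" using I by simp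
    finally show ?thesis by (simp add: A_def)
  qed
qed

text \<open>The probability that a uniformly random member of \<open>\<T>\<close> contains
  \<open>e\<close>. For the spanning trees of a connected graph this is the effective resistance
  between the ends of \<open>e\<close> when all edges have unit resistance.\<close>

definition edge_frequency :: "'e set set \<Rightarrow> 'e \<Rightarrow> real" where
  "edge_frequency \<T> e = real (card {T \<in> \<T>. e \<in> T}) / real (card \<T>)"

lemma edge_frequency_pos:
  assumes "finite \<T>" "e \<in> \<Union>\<T>"
  shows "edge_frequency \<T> e > 0"
proof -
  have "{T \<in> \<T>. e \<in> T} \<noteq> {}" "\<T> \<noteq> {}" using assms(2) by auto
  then show ?thesis using assms(1) by (simp add: edge_frequency_def card_gt_0_iff)
qed

text \<open>Exchanges a geometric mean over trees for a product over edges weighted by frequency; it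
  is applied to the cosine powers, to their bounds and to the frequencies themselves.\<close>

lemma prod_powr_card_Union:
  assumes "finite \<T>" "\<And>T. T \<in> \<T> \<Longrightarrow> finite T" "\<And>e. f e \<ge> 0"
  shows "(\<Prod>T\<in>\<T>. \<Prod>e\<in>T. f e) powr (1 / card \<T>) = (\<Prod>e\<in>\<Union>\<T>. f e powr edge_frequency \<T> e)"
proof -
  have "(f e ^ card {T \<in> \<T>. e \<in> T}) powr (1 / card \<T>) = f e powr edge_frequency \<T> e"
    if "e \<in> \<Union>\<T>" for e
  proof -
    \<comment> \<open>Needed where \<open>f e = 0\<close>: \<open>0 ^ 0\<close> is 1, but
      \<open>0 powr 0\<close> is 0.\<close>
    have "card {T \<in> \<T>. e \<in> T} \<noteq> 0" using that assms(1) by auto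
    then show ?thesis
      using assms(3)[of e] by (simp add: powr_powr edge_frequency_def flip: powr_realpow')
  qed
  then show ?thesis
    by (simp add: prod_prod_Union[OF assms(1,2)] prod_powr_distrib)
qed

text \<open>Both sides are the mean size of a member of \<open>\<T>\<close>, by counting incident
  pairs of edges and members.\<close>

lemma sum_edge_frequency:
  assumes "finite \<T>" "\<T> \<noteq> {}" "\<And>T. T \<in> \<T> \<Longrightarrow> finite T \<and> card T = m"
  shows "(\<Sum>e\<in>\<Union>\<T>. edge_frequency \<T> e) = real m"
proof -
  have "(\<Sum>e\<in>\<Union>\<T>. real (card {T \<in> \<T>. e \<in> T})) = (\<Sum>e\<in>\<Union>\<T>. \<Sum>T\<in>{T. T \<in> \<T> \<and> e \<in> T}. 1)"
    by simp
  also have "\<dots> = (\<Sum>T\<in>\<T>. \<Sum>e\<in>{e. e \<in> \<Union>\<T> \<and> e \<in> T}. 1)"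
    using assms by (intro sum.swap_restrict) auto
  also have "\<dots> = (\<Sum>T\<in>\<T>. real (card T))"
    by (intro sum.cong refl) (auto intro!: arg_cong[where f = card])
  also have "\<dots> = real (card \<T>) * real m"
    using assms(3) by simp
  finally show ?thesis
    using assms(1,2) by (simp add: edge_frequency_def flip: sum_divide_distrib)
qed

text \<open>
  An entropy bound: the product on the left is \<open>exp\<close> of minus the sum of \<open>-c ln c\<close> over the
  edge frequencies \<open>c\<close>. It follows by expanding the product of the \<open>1 + c\<close>.
\<close>
lemma card_mult_prod_edge_frequency_le:
  assumes "finite \<T>" "\<T> \<noteq> {}" "\<And>T. T \<in> \<T> \<Longrightarrow> finite T \<and> card T = m"
  shows "real (card \<T>) * (\<Prod>e\<in>\<Union>\<T>. edge_frequency \<T> e powr edge_frequency \<T> e) \<le> exp (real m)"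
proof -
  let ?c = "edge_frequency \<T>"
  have c0: "?c e \<ge> 0" for e by (simp add: edge_frequency_def)
  have fin: "finite (\<Union>\<T>)" using assms by auto
  \<comment> \<open>AM-GM over the members of \<open>\<T>\<close>, each weighted by the product of
    its frequencies; the geometric mean is the product of the \<open>c powr c\<close>.\<close>
  have "(\<Prod>T\<in>\<T>. \<Prod>e\<in>T. ?c e) powr (1 / card \<T>) \<le> (\<Sum>T\<in>\<T>. (\<Prod>e\<in>T. ?c e) / card \<T>)"
    using assms c0 by (intro arith_geom_mean prod_nonneg) auto
  then have "real (card \<T>) * (\<Prod>e\<in>\<Union>\<T>. ?c e powr ?c e) \<le> (\<Sum>T\<in>\<T>. \<Prod>e\<in>T. ?c e)"
    using assms c0
    by (subst (asm) prod_powr_card_Union) (auto simp: field_simps card_gt_0_iff simp flip: sum_divide_distrib)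
  \<comment> \<open>The members are distinct subsets of the union; admitting all subsets gives a sum
    that factors.\<close>
  also have "\<dots> \<le> (\<Sum>X\<in>Pow (\<Union>\<T>). \<Prod>e\<in>X. ?c e)"
    using fin c0 by (intro sum_mono2 prod_nonneg) auto
  also have "\<dots> = (\<Prod>e\<in>\<Union>\<T>. ?c e + 1)"
    using prod_add[OF fin, of ?c "\<lambda>_. 1"] by simp
  also have "\<dots> \<le> (\<Prod>e\<in>\<Union>\<T>. exp (?c e))"
    using c0 by (intro prod_mono) (auto simp: add.commute)
  also have "\<dots> = exp (real m)"
    using sum_edge_frequency[OF assms] fin by (simp flip: exp_sum)
  finally show ?thesis .
qed

subsection \<open>Fourier inversion\<close>

lemma cos_periodic_mod:
  assumes "M > 0"
  shows "cos (2 * pi * of_int (i mod int M) / real M) = cos (2 * pi * of_int i / real M)"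
proof -
  have "real_of_int i = of_int (i mod int M) + real M * of_int (i div int M)"
    by (metis mod_mult_div_eq of_int_add of_int_mult of_int_of_nat_eq)
  then have "2 * pi * of_int i / real M =
      2 * pi * of_int (i mod int M) / real M + 2 * pi * of_int (i div int M)"
    using assms by (simp add: field_simps)
  then show ?thesis by (simp add: cos_add)
qed

lemma sum_periodic_shift:
  fixes h :: "int \<Rightarrow> real"
  assumes "M > 0" and h: "\<And>i. h (i mod int M) = h i"
  shows "(\<Sum>x\<in>{0..<int M}. h (x - y)) = (\<Sum>j\<in>{0..<int M}. h j)"
  by (rule sum.reindex_bij_witness[of _ "\<lambda>j. (j + y) mod int M" "\<lambda>x. (x - y) mod int M"])
    (use assms in \<open>auto simp: mod_simps\<close>)

text \<open>A geometric sum over powers of an \<open>M\<close>-th root of unity is \<open>M\<close>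
  or 0. For an upper bound on the count it is enough that terms with \<open>d \<noteq> 0\<close> are
  nonnegative.\<close>

lemma sum_cis_nonneg:
  fixes d :: int
  assumes "M > 0"
  shows "\<exists>r\<ge>0. (d = 0 \<longrightarrow> r = real M) \<and>
    (\<Sum>j\<in>{0..<int M}. cis (2 * pi * of_int j / real M * of_int d)) = complex_of_real r"
proof -
  define z where "z = cis (2 * pi * of_int d / real M)"
  have "z ^ M = cis (real M * (2 * pi * of_int d / real M))"
    unfolding z_def by (rule Complex.DeMoivre)
  also have "real M * (2 * pi * of_int d / real M) = 2 * pi * of_int d"
    using assms by simp
  also have "cis \<dots> = 1" by (rule cis_multiple_2pi) simp
  finally have zM: "z ^ M = 1" .
  have "(\<Sum>j\<in>{0..<int M}. cis (2 * pi * of_int j / real M * of_int d)) = (\<Sum>j<M. z ^ j)"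
    by (rule sum.reindex_bij_witness[of _ int nat])
      (auto simp: z_def Complex.DeMoivre mult_ac)
  also have "\<dots> = complex_of_real (if z = 1 then real M else 0)"
    using geometric_sum[of z M] zM by auto
  finally show ?thesis
    by (intro exI[of _ "if z = 1 then real M else 0"]) (auto simp: z_def)
qed

lemma prod_cis: "finite A \<Longrightarrow> (\<Prod>x\<in>A. cis (f x)) = cis (\<Sum>x\<in>A. f x)"
  by (induction A rule: finite_induct) (simp_all add: cis_mult)

text \<open>
  Without the absolute values, the right-hand side is \<open>M\<^bsup>|V|\<^esup>\<close> times the number of orientations
  in which \<open>M\<close> divides out-degree minus in-degree at every vertex.
\<close>
lemma EO_le_sum_cos:
  fixes G :: "('v, 'e) multigraph"
  assumes G: "loopless_multigraph G" and M: "M > 0"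
    and ab: "\<And>e. e \<in> edges G \<Longrightarrow> ends G e = {a e, b e}"
  shows "real M ^ card (vertices G) * real (EO G) \<le>
    (\<Sum>k\<in>PiE (vertices G) (\<lambda>_. {0..<int M}). \<Prod>e\<in>edges G.
      2 * \<bar>cos (2 * pi * of_int (k (a e) - k (b e)) / real M)\<bar>)"
proof -
  define V E Z where "V = vertices G" and "E = edges G" and "Z = {0..<int M}"
  define \<omega> where "\<omega> k v = 2 * pi * of_int (k v) / real M" for k :: "'v \<Rightarrow> int" and v
  \<comment> \<open>Out-degree minus in-degree of \<open>v\<close> under \<open>D\<close>.\<close>
  define d where "d D v = int (card {e \<in> E. fst (D e) = v}) - int (card {e \<in> E. snd (D e) = v})"
    for D :: "'e \<Rightarrow> 'v \<times> 'v" and v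
  define C where "C k e = 2 * cos (\<omega> k (a e) - \<omega> k (b e))" for k e
  have finV: "finite V" and finE: "finite E" and EV: "\<And>e. e \<in> E \<Longrightarrow> ends G e \<subseteq> V"
    using G by (auto simp: loopless_multigraph_def V_def E_def)
  have P: "{(u, v). {u, v} = ends G e} = {(a e, b e), (b e, a e)}" if "e \<in> E" for e
    using ab[of e] that by (auto simp: E_def doubleton_eq_iff)
  have a_neq_b: "a e \<noteq> b e" if "e \<in> E" for e
    using ab[of e] loopless_multigraph.card_ends[OF G, of e] that by (auto simp: E_def)
  have orient: "orientations G = (\<Pi>\<^sub>E e\<in>E. {(u, v). {u, v} = ends G e})"
    by (simp add: orientations_def E_def)
  have fin_orient: "finite (orientations G)"
    unfolding orient using finE P by (intro finite_PiE) auto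
  \<comment> \<open>The two orientations of an edge contribute conjugate phases, which add up to
    twice a cosine.\<close>
  have C_eq: "complex_of_real (C k e) =
      (\<Sum>p\<in>{(u, v). {u, v} = ends G e}. cis (\<omega> k (fst p) - \<omega> k (snd p)))" if "e \<in> E" for k e
  proof -
    have "cis x + cis (- x) = complex_of_real (2 * cos x)" for x
      by (simp add: complex_eq_iff)
    from this[of "\<omega> k (a e) - \<omega> k (b e)"] show ?thesis
      using a_neq_b[OF that] by (simp add: P[OF that] C_def)
  qed
  \<comment> \<open>Groups the edges by tail (\<open>h = fst\<close>) or by head
    (\<open>h = snd\<close>); the difference of the two sums brings in \<open>d\<close>.\<close>
  have tail_sum: "(\<Sum>e\<in>E. \<omega> k (h (D e))) = (\<Sum>v\<in>V. \<omega> k v * real (card {e \<in> E. h (D e) = v}))"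
    if "\<And>e. e \<in> E \<Longrightarrow> h (D e) \<in> V" for k D and h :: "'v \<times> 'v \<Rightarrow> 'v"
  proof -
    have "(\<Sum>e\<in>E. \<omega> k (h (D e))) = (\<Sum>v\<in>V. \<Sum>e\<in>{e \<in> E. h (D e) = v}. \<omega> k (h (D e)))"
      using that finE finV by (intro sum.group[symmetric]) auto
    also have "\<dots> = (\<Sum>v\<in>V. \<Sum>e\<in>{e \<in> E. h (D e) = v}. \<omega> k v)"
      by (intro sum.cong refl) auto
    finally show ?thesis by (simp add: mult.commute)
  qed
  have D_prod: "(\<Prod>e\<in>E. cis (\<omega> k (fst (D e)) - \<omega> k (snd (D e)))) =
      (\<Prod>v\<in>V. cis (\<omega> k v * of_int (d D v)))" if D: "D \<in> orientations G" for k D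
  proof -
    have "fst (D e) \<in> V \<and> snd (D e) \<in> V" if "e \<in> E" for e
    proof -
      have "D e \<in> {(u, v). {u, v} = ends G e}"
        using D that unfolding orient by (rule PiE_mem)
      then show ?thesis using EV[OF that] by auto
    qed
    then show ?thesis
      using tail_sum[of fst D k] tail_sum[of snd D k] finE finV
      by (simp add: prod_cis sum_subtractf d_def right_diff_distrib)
  qed
  obtain r where r: "\<And>i. r i \<ge> 0" "r 0 = real M"
    "\<And>i. (\<Sum>j\<in>Z. cis (2 * pi * of_int j / real M * of_int i)) = complex_of_real (r i)"
    using sum_cis_nonneg[OF M] unfolding Z_def by metis
  have "complex_of_real (\<Sum>k\<in>PiE V (\<lambda>_. Z). \<Prod>e\<in>E. C k e) =
      (\<Sum>k\<in>PiE V (\<lambda>_. Z). \<Prod>e\<in>E. \<Sum>p\<in>{(u, v). {u, v} = ends G e}. cis (\<omega> k (fst p) - \<omega> k (snd p)))"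
    by (simp add: C_eq)
  \<comment> \<open>Expanding the product over edges picks one ordered pair per edge, that is, an
    orientation.\<close>
  also have "\<dots> = (\<Sum>k\<in>PiE V (\<lambda>_. Z). \<Sum>D\<in>orientations G. \<Prod>e\<in>E. cis (\<omega> k (fst (D e)) - \<omega> k (snd (D e))))"
    unfolding orient using finE P by (intro sum.cong refl prod_sum_PiE) auto
  also have "\<dots> = (\<Sum>D\<in>orientations G. \<Sum>k\<in>PiE V (\<lambda>_. Z). \<Prod>e\<in>E. cis (\<omega> k (fst (D e)) - \<omega> k (snd (D e))))"
    by (rule sum.swap)
  also have "\<dots> = (\<Sum>D\<in>orientations G. \<Sum>k\<in>PiE V (\<lambda>_. Z). \<Prod>v\<in>V. cis (\<omega> k v * of_int (d D v)))"
    by (intro sum.cong refl) (simp add: D_prod)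
  \<comment> \<open>For a fixed orientation the phase factors over the vertices, so the labels are
    summed independently.\<close>
  also have "\<dots> = (\<Sum>D\<in>orientations G. \<Prod>v\<in>V. \<Sum>j\<in>Z. cis (2 * pi * of_int j / real M * of_int (d D v)))"
    unfolding \<omega>_def using finV
    by (intro sum.cong refl prod_sum_PiE[symmetric]) (auto simp: Z_def)
  also have "\<dots> = complex_of_real (\<Sum>D\<in>orientations G. \<Prod>v\<in>V. r (d D v))"
    by (simp only: r(3) of_real_sum of_real_prod)
  finally have fourier: "(\<Sum>k\<in>PiE V (\<lambda>_. Z). \<Prod>e\<in>E. C k e) = (\<Sum>D\<in>orientations G. \<Prod>v\<in>V. r (d D v))"
    by (simp only: of_real_eq_iff)
  have "d D v = 0" if "D \<in> eulerian_orientations G" "v \<in> V" for D v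
    using that by (auto simp: eulerian_orientations_def d_def V_def E_def in_degree_def out_degree_def
        in_arcs_def out_arcs_def oriented_digraph_def)
  then have "real M ^ card V * real (EO G) = (\<Sum>D\<in>eulerian_orientations G. \<Prod>v\<in>V. r (d D v))"
    by (simp add: r(2) EO_def)
  also have "\<dots> \<le> (\<Sum>D\<in>orientations G. \<Prod>v\<in>V. r (d D v))"
    using fin_orient r(1) by (intro sum_mono2 prod_nonneg) (auto simp: eulerian_orientations_def)
  \<comment> \<open>Absolute values prepare for the real powers in Hoelder's inequality, since the
    cosines may be negative.\<close>
  also have "\<dots> \<le> (\<Sum>k\<in>PiE V (\<lambda>_. Z). \<Prod>e\<in>E. \<bar>C k e\<bar>)"
    unfolding fourier[symmetric] by (intro sum_mono) (simp flip: abs_prod)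
  finally show ?thesis
    by (simp add: C_def \<omega>_def V_def E_def Z_def abs_mult diff_divide_distrib right_diff_distrib)
qed

section \<open>Hoelder's inequality over the spanning trees\<close>

text \<open>The cosine product is at most a geometric mean of products over single trees. Hoelder's
  inequality takes the sum over labels inside, where it factors along each tree, and the powers of
  \<open>M\<close> cancel. \<open>K\<close> stays free for a later limit.\<close>

lemma EO_le_prod_edge_frequency:
  fixes G :: "('v, 'e) multigraph"
  assumes G: "loopless_multigraph G" "connected_multigraph G" and K: "K > 0"
  defines "\<T> \<equiv> spanning_trees G"
  shows "real (EO G) \<le> 2 ^ card (edges G) *
    (\<Prod>e\<in>\<Union>\<T>. (1 / real K + sqrt (2 * edge_frequency \<T> e / pi)) powr edge_frequency \<T> e)"
proof -
  define V E where "V = vertices G" and "E = edges G"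
  define M where "M = 4 * K"
  define Ks where "Ks = PiE V (\<lambda>_. {0..<int M})"
  define c where "c = edge_frequency \<T>"
  define A where "A e = 1 / real K + sqrt (2 * c e / pi)" for e
  have M: "M > 0" using K by (simp add: M_def)
  have finV: "finite V" and finE: "finite E"
    using G by (auto simp: loopless_multigraph_def V_def E_def)
  have "\<exists>x y. ends G e = {x, y}" if "e \<in> E" for e
    using loopless_multigraph.card_ends[OF G(1)] that unfolding E_def card_2_iff by blast
  then obtain a b where ab: "\<And>e. e \<in> E \<Longrightarrow> ends G e = {a e, b e}" by metis
  have TE: "T \<subseteq> E" if "T \<in> \<T>" for T
    using that by (auto simp: \<T>_def spanning_trees_def E_def)
  have finT: "finite T" if "T \<in> \<T>" for T using TE[OF that] finE finite_subset by blast
  have "\<T> \<subseteq> Pow E" using TE by blast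
  then have fin\<T>: "finite \<T>" using finE finite_subset by blast
  have ne: "\<T> \<noteq> {}" using spanning_trees_nonempty[OF G] by (simp add: \<T>_def)
  have grown: "grown_tree (ends G) V T" if "T \<in> \<T>" for T
    using spanning_tree_grown[OF G(1)] that by (simp add: \<T>_def V_def)
  have finKs: "finite Ks" unfolding Ks_def using finV by (intro finite_PiE) auto
  have c_pos: "c e > 0" if "e \<in> \<Union>\<T>" for e
    unfolding c_def using edge_frequency_pos[OF fin\<T> that] .
  have A0: "A e \<ge> 0" for e by (simp add: A_def c_def edge_frequency_def)
  \<comment> \<open>The exponent \<open>1 / c e\<close> cancels the weight \<open>c e\<close> that
    \<open>e\<close> receives from the trees containing it.\<close>
  define h where "h e j = \<bar>cos (2 * pi * of_int j / real M)\<bar> powr (1 / c e)" for e and j :: int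
  define H where "H e = (\<Sum>j\<in>{0..<int M}. h e j)" for e
  have h_mod: "h e (i mod int M) = h e i" for e i
    using cos_periodic_mod[OF M] by (simp add: h_def)
  have h_even: "h e (x - y) = h e (y - x)" for e x y
  proof -
    have "real_of_int (x - y) = - of_int (y - x)" by simp
    then have "2 * pi * of_int (x - y) / real M = - (2 * pi * of_int (y - x) / real M)"
      by (simp only: mult_minus_right minus_divide_left)
    then show ?thesis unfolding h_def by (metis cos_minus)
  qed
  have H: "H e \<le> real M * A e" if "e \<in> \<Union>\<T>" for e
    using sum_abs_cos_powr_le[OF K, of "1 / c e"] c_pos[OF that]
    by (simp add: H_def h_def M_def A_def mult_ac)
  have tree_sum: "(\<Sum>k\<in>Ks. \<Prod>e\<in>T. h e (k (a e) - k (b e))) = real M * (\<Prod>e\<in>T. H e)"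
    if T: "T \<in> \<T>" for T
  proof -
    have "(\<Sum>x\<in>{0..<int M}. h e (x - y)) = H e" for e y
      unfolding H_def using M h_mod by (intro sum_periodic_shift)
    moreover from this have "(\<Sum>x\<in>{0..<int M}. h e (y - x)) = H e" for e y
      by (simp only: h_even[of e y])
    moreover have "ends G e = {a e, b e}" if "e \<in> T" for e
      using ab TE[OF T] that by blast
    ultimately have "(\<Sum>k\<in>Ks. \<Prod>e\<in>T. h e (k (a e) - k (b e))) = real (card {0..<int M}) * (\<Prod>e\<in>T. H e)"
      unfolding Ks_def by (intro grown_tree_sum[OF grown[OF T]]) auto
    then show ?thesis by simp
  qed
  \<comment> \<open>One factor \<open>M\<close> comes from the free label and one from each of the
    \<open>card V - 1\<close> edges of \<open>T\<close>.\<close>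
  have tree_bound: "real M * (\<Prod>e\<in>T. H e) \<le> real M ^ card V * (\<Prod>e\<in>T. A e)" if T: "T \<in> \<T>" for T
  proof -
    have "(\<Prod>e\<in>T. H e) \<le> (\<Prod>e\<in>T. real M * A e)"
      using H T by (intro prod_mono) (auto simp: H_def h_def intro!: sum_nonneg)
    then show ?thesis
      using grown_tree_card[OF grown[OF T]] M by (simp add: prod.distrib mult.assoc)
  qed
  have cos_prod: "(\<Prod>e\<in>E. \<bar>cos (2 * pi * of_int (k (a e) - k (b e)) / real M)\<bar>) \<le>
      (\<Prod>T\<in>\<T>. (\<Prod>e\<in>T. h e (k (a e) - k (b e))) powr (1 / card \<T>))" for k
  proof -
    let ?x = "\<lambda>e. \<bar>cos (2 * pi * of_int (k (a e) - k (b e)) / real M)\<bar>"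
    have "(\<Prod>e\<in>E. ?x e) = (\<Prod>e\<in>E - \<Union>\<T>. ?x e) * (\<Prod>e\<in>\<Union>\<T>. ?x e)"
      using TE finE by (intro prod.subset_diff) auto
    \<comment> \<open>Factors of edges outside the union are at most 1 and are dropped.\<close>
    also have "\<dots> \<le> 1 * (\<Prod>e\<in>\<Union>\<T>. ?x e)"
      by (intro mult_right_mono prod_le_1 prod_nonneg) auto
    also have "\<dots> = (\<Prod>e\<in>\<Union>\<T>. h e (k (a e) - k (b e)) powr c e)"
    proof (subst mult_1, intro prod.cong refl)
      fix e assume "e \<in> \<Union>\<T>"
      then have "c e \<noteq> 0" using c_pos by force
      then show "?x e = h e (k (a e) - k (b e)) powr c e" by (simp add: h_def powr_powr)
    qed
    also have "\<dots> = (\<Prod>T\<in>\<T>. \<Prod>e\<in>T. h e (k (a e) - k (b e))) powr (1 / card \<T>)"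
      unfolding c_def using fin\<T> finT
      by (intro prod_powr_card_Union[symmetric]) (auto simp: h_def)
    finally show ?thesis by (simp add: prod_powr_distrib)
  qed
  have "real M ^ card V * real (EO G) \<le>
      (\<Sum>k\<in>Ks. \<Prod>e\<in>E. 2 * \<bar>cos (2 * pi * of_int (k (a e) - k (b e)) / real M)\<bar>)"
    unfolding V_def E_def Ks_def using EO_le_sum_cos[OF G(1) M] ab by (simp add: E_def)
  also have "\<dots> = 2 ^ card E * (\<Sum>k\<in>Ks. \<Prod>e\<in>E. \<bar>cos (2 * pi * of_int (k (a e) - k (b e)) / real M)\<bar>)"
    by (simp add: prod.distrib sum_distrib_left)
  also have "\<dots> \<le> 2 ^ card E * (\<Sum>k\<in>Ks. \<Prod>T\<in>\<T>. (\<Prod>e\<in>T. h e (k (a e) - k (b e))) powr (1 / card \<T>))"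
    using cos_prod by (intro mult_left_mono sum_mono) auto
  also have "\<dots> \<le> 2 ^ card E * (\<Prod>T\<in>\<T>. (\<Sum>k\<in>Ks. \<Prod>e\<in>T. h e (k (a e) - k (b e))) powr (1 / card \<T>))"
    using finKs fin\<T> ne by (intro mult_left_mono Holder_prod_powr_card prod_nonneg) (auto simp: h_def)
  also have "\<dots> \<le> 2 ^ card E * (\<Prod>T\<in>\<T>. (real M ^ card V * (\<Prod>e\<in>T. A e)) powr (1 / card \<T>))"
  proof (intro mult_left_mono prod_mono conjI)
    fix T assume T: "T \<in> \<T>"
    have "0 \<le> real M * (\<Prod>e\<in>T. H e)"
      by (intro mult_nonneg_nonneg prod_nonneg) (auto simp: H_def h_def intro!: sum_nonneg)
    then show "(\<Sum>k\<in>Ks. \<Prod>e\<in>T. h e (k (a e) - k (b e))) powr (1 / card \<T>) \<le>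
        (real M ^ card V * (\<Prod>e\<in>T. A e)) powr (1 / card \<T>)"
      unfolding tree_sum[OF T] by (intro powr_mono2 tree_bound[OF T]) auto
  qed auto
  also have "(\<Prod>T\<in>\<T>. (real M ^ card V * (\<Prod>e\<in>T. A e)) powr (1 / card \<T>)) =
      real M ^ card V * (\<Prod>e\<in>\<Union>\<T>. A e powr c e)"
  proof -
    have "(\<Prod>T\<in>\<T>. (real M ^ card V) powr (1 / card \<T>)) = real M ^ card V"
      using fin\<T> ne M by (simp add: powr_powr flip: powr_realpow)
    moreover have "(\<Prod>T\<in>\<T>. (\<Prod>e\<in>T. A e) powr (1 / card \<T>)) = (\<Prod>e\<in>\<Union>\<T>. A e powr c e)"
      unfolding c_def prod_powr_distrib[symmetric]
      using fin\<T> finT A0 by (intro prod_powr_card_Union) auto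
    ultimately show ?thesis by (simp add: powr_mult prod.distrib)
  qed
  finally have "real M ^ card V * real (EO G) \<le> real M ^ card V * (2 ^ card E * (\<Prod>e\<in>\<Union>\<T>. A e powr c e))"
    by (simp add: mult_ac)
  then show ?thesis using M by (simp add: A_def c_def E_def)
qed

section \<open>Limit of fine grids and the entropy bound\<close>

theorem theorem2p6:
  fixes G :: "('v, 'e) multigraph" and n :: nat
  assumes "loopless_multigraph G"
    and "connected_multigraph G"
    and "n = card (vertices G)"
    and "\<forall>v \<in> vertices G. even (vertex_degree G v)"
  shows "real (EO G) \<le>
    2 powr (real (card (edges G)) + 3 * (real n - 1) / 2) /
    (pi powr ((real n - 1) / 2) * real (num_spanning_trees G) powr (1 / 2))"
proof -
  note G = assms(1,2)
  define \<T> where "\<T> = spanning_trees G"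
  define c where "c = edge_frequency \<T>"
  define t where "t = real (card \<T>)"
  define m where "m = real n - 1"
  have "\<T> \<subseteq> Pow (edges G)" by (auto simp: \<T>_def spanning_trees_def)
  then have fin\<T>: "finite \<T>"
    using loopless_multigraph.finite_edges[OF G(1)] finite_subset by blast
  have ne: "\<T> \<noteq> {}" using spanning_trees_nonempty[OF G] by (simp add: \<T>_def)
  have t: "t > 0" using fin\<T> ne by (simp add: t_def card_gt_0_iff)
  have "grown_tree (ends G) (vertices G) T" if "T \<in> \<T>" for T
    using spanning_tree_grown[OF G(1)] that by (simp add: \<T>_def)
  then have trees: "finite T \<and> card T = n - 1" "n > 0" if "T \<in> \<T>" for T
    using that grown_tree_card grown_tree_finite assms(3) by fastforce+
  have "n > 0" using trees(2) ne by blast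
  then have m: "real (n - 1) = m" by (simp add: m_def of_nat_diff)
  have c_pos: "c e > 0" if "e \<in> \<Union>\<T>" for e
    unfolding c_def using edge_frequency_pos[OF fin\<T> that] .
  have c_sum: "(\<Sum>e\<in>\<Union>\<T>. c e) = m"
    unfolding c_def m[symmetric] using fin\<T> ne trees(1) by (intro sum_edge_frequency)
  have entropy: "t * (\<Prod>e\<in>\<Union>\<T>. c e powr c e) \<le> exp m"
    unfolding c_def m[symmetric] t_def using fin\<T> ne trees(1)
    by (intro card_mult_prod_edge_frequency_le)
  \<comment> \<open>Positive frequencies keep the limits of the bases away from 0, where
    \<open>powr\<close> could fail to be continuous.\<close>
  have lim: "(\<lambda>K. 2 ^ card (edges G) * (\<Prod>e\<in>\<Union>\<T>. (1 / real K + sqrt (2 * c e / pi)) powr c e))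
      \<longlonglongrightarrow> 2 ^ card (edges G) * (\<Prod>e\<in>\<Union>\<T>. (0 + sqrt (2 * c e / pi)) powr c e)"
    using c_pos by (intro tendsto_intros lim_1_over_n) auto
  have "real (EO G) \<le> 2 ^ card (edges G) * (\<Prod>e\<in>\<Union>\<T>. (0 + sqrt (2 * c e / pi)) powr c e)"
    by (rule LIMSEQ_le_const[OF lim])
      (use EO_le_prod_edge_frequency[OF G] in \<open>auto simp: c_def \<T>_def intro!: exI[of _ 1]\<close>)
  also have "(\<Prod>e\<in>\<Union>\<T>. (0 + sqrt (2 * c e / pi)) powr c e) =
      (\<Prod>e\<in>\<Union>\<T>. (2 / pi) powr (c e / 2) * (c e powr c e) powr (1 / 2))"
  proof (intro prod.cong refl)
    fix e assume "e \<in> \<Union>\<T>"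
    then have "c e > 0" by (rule c_pos)
    then have "0 + sqrt (2 * c e / pi) = ((2 / pi) * c e) powr (1 / 2)"
      by (simp add: powr_half_sqrt)
    then show "(0 + sqrt (2 * c e / pi)) powr c e = (2 / pi) powr (c e / 2) * (c e powr c e) powr (1 / 2)"
      by (simp only: powr_powr powr_mult) simp
  qed
  also have "\<dots> = (2 / pi) powr (m / 2) * (\<Prod>e\<in>\<Union>\<T>. c e powr c e) powr (1 / 2)"
    by (simp add: prod.distrib prod_powr_distrib sum_divide_distrib[symmetric] c_sum flip: powr_sum)
  finally have EO: "real (EO G) \<le>
      2 ^ card (edges G) * ((2 / pi) powr (m / 2) * (\<Prod>e\<in>\<Union>\<T>. c e powr c e) powr (1 / 2))" .
  \<comment> \<open>Weakening \<open>exp 1\<close> to 4 gives the constant of the claim: the square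
    root of \<open>4 powr m\<close> is \<open>2 powr m\<close>, and
    \<open>(2 / pi) powr (m / 2)\<close> supplies the rest.\<close>
  have "(\<Prod>e\<in>\<Union>\<T>. c e powr c e) \<le> 4 powr m / t"
  proof -
    have "exp m = exp 1 powr m" by (simp add: exp_powr_real)
    also have "\<dots> \<le> 4 powr m" using exp_le m by (intro powr_mono2) auto
    finally have "exp m \<le> 4 powr m" .
    then show ?thesis using entropy t by (simp add: field_simps)
  qed
  then have "(\<Prod>e\<in>\<Union>\<T>. c e powr c e) powr (1 / 2) \<le> (4 powr m / t) powr (1 / 2)"
    by (intro powr_mono2 prod_nonneg) auto
  then have le: "2 ^ card (edges G) * ((2 / pi) powr (m / 2) * (\<Prod>e\<in>\<Union>\<T>. c e powr c e) powr (1 / 2)) \<le>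
      2 ^ card (edges G) * ((2 / pi) powr (m / 2) * (4 powr m / t) powr (1 / 2))"
    by (intro mult_left_mono) auto
  note EO
  also note le
  also have "(4 powr m / t) powr (1 / 2) = 2 powr m / t powr (1 / 2)"
  proof -
    have "(4::real) = 2 powr 2" by simp
    then have "4 powr m = (2 powr m) powr (2::real)" by (metis powr_powr mult.commute)
    then show ?thesis by (simp add: powr_divide powr_powr)
  qed
  also have "2 ^ card (edges G) * ((2 / pi) powr (m / 2) * (2 powr m / t powr (1 / 2))) =
      2 powr (real (card (edges G)) + 3 * m / 2) / (pi powr (m / 2) * t powr (1 / 2))"
  proof -
    have "2 powr (real (card (edges G)) + 3 * m / 2) = 2 ^ card (edges G) * (2 powr (m / 2) * 2 powr m)"
      by (simp add: powr_realpow[symmetric] powr_add[symmetric])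
    then show ?thesis by (simp add: powr_divide)
  qed
  finally show ?thesis
    by (simp add: m_def t_def \<T>_def num_spanning_trees_def)
qed

end
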